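(* Let $X$ be the diffusion, $g$ the reward function and $V(x)=\sup_\tau\mathbf{E}_x\{e^{-r\tau}g(X_\tau)\}$ the optimal stopping value described in the context, with continuation region $C=\{x\in\mathbb{R}_+\mid V(x)>g(x)\}$. (A) Let $C_\psi=\{x\in\mathbb{R}_+\mid g/\psi \text{ is strictly increasing at } x\}$. Then $C_\psi\subset C$. (B) Let $C_\varphi=\{x\in\mathbb{R}_+\mid g/\varphi \text{ is strictly decreasing at } x\}$. Then $C_\varphi\subset C$.
   Context: Diffusion: $X$ is a regular linear diffusion on $\mathbb{R}_+=(0,\infty)$, defined on a filtered probability space $(\Omega,\mathcal F,\{\mathcal F_t\},\mathbf P)$, solving $dX_t=\mu(X_t)dt+\sigma(X_t)dW_t$, $X_0=x$, where $\mu:\mathbb{R}_+\to\mathbb{R}$ and $\sigma:\mathbb{R}_+\to\mathbb{R}_+$ are measurable and every $x\in\mathbb{R}_+$ has an $\varepsilon>0$ with $\int_{x-\varepsilon}^{x+\varepsilon}\frac{1+|\mu(y)|}{\sigma^2(y)}dy<\infty$ (so a unique weak solution exists). Each of the boundaries $0,\infty$ is natural, exit, entrance or killing. When $X$ hits an exit or killing boundary it is sent immediately to a cemetery state $\partial\notin\mathbb{R}_+$, where it stays; boundaries can never be used as stopping points. $\mathbf{E}_x$ is expectation given $X_0=x$. Stopping problem: $r>0$ is constant; $g:(0,\infty)\to\mathbb{R}$ is upper semicontinuous and $g(x)>0$ for some $x$; $g(\partial)=0$, and $e^{-r\tau}g(X_\tau)=0$ on $\{\tau=\infty\}$. The supremum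 defining $V$ is over all $\mathcal F_t$-stopping times. Fundamental solutions: $\psi>0$ and $\varphi>0$ are the increasing and decreasing fundamental solutions of $(\mathcal A-r)u=0$, $\mathcal A=\tfrac12\sigma^2(x)\frac{d^2}{dx^2}+\mu(x)\frac{d}{dx}$. With $\tau_z=\inf\{t\ge0\mid X_t=z\}$, they satisfy $\mathbf{E}_x\{e^{-r\tau_z}\}=\psi(x)/\psi(z)$ for $x\le z$ and $=\varphi(x)/\varphi(z)$ for $x\ge z$. A function is said to be strictly increasing (decreasing) at $x$ if it is strictly increasing (decreasing) on some open interval containing $x$. *)

theory Defs
  imports "HOL-Probability.Probability"
begin

text \<open>
  A path takes values in \<open>(0,\<infinity>)\<close> together with the cemetery state; \<open>Some y\<close> is the
  state \<open>y\<close> and \<open>None\<close> is the cemetery. Time is \<open>real\<close> for processes (only times \<open>t \<ge> 0\<close>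
  matter) and \<^typ>\<open>ennreal\<close> for random times and filtrations, so that the library's
  \<^const>\<open>stopping_time\<close> covers stopping times with values in \<open>[0,\<infinity>]\<close>. At \<open>t = \<infinity>\<close> its
  measurability condition is vacuous, so the choice of \<open>F \<infinity>\<close> is immaterial.
\<close>

definition state_space :: "real option measure" where
  "state_space = sigma UNIV ((`) Some ` sets borel)"

definition hitting_time :: "(real \<Rightarrow> 'w \<Rightarrow> real option) \<Rightarrow> real \<Rightarrow> 'w \<Rightarrow> ennreal" where
  "hitting_time X z \<omega> = Inf {ennreal t | t. 0 \<le> t \<and> X t \<omega> = Some z}"

definition lifetime :: "(real \<Rightarrow> 'w \<Rightarrow> real option) \<Rightarrow> 'w \<Rightarrow> ennreal" where
  "lifetime X \<omega> = Inf {ennreal t | t. 0 \<le> t \<and> X t \<omega> = None}"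

definition exit_time :: "(real \<Rightarrow> 'w \<Rightarrow> real option) \<Rightarrow> real \<Rightarrow> real \<Rightarrow> 'w \<Rightarrow> ennreal" where
  "exit_time X a b \<omega> = Inf {ennreal t | t. 0 \<le> t \<and> X t \<omega> \<notin> Some ` {a<..<b}}"

text \<open>
  The path is continuous in \<open>(0,\<infinity>)\<close> before its lifetime; a finite lifetime is the first time
  the path reaches \<open>0\<close> or \<open>\<infinity>\<close>, and from then on the path stays in the cemetery. There is
  no return from a boundary, so a boundary that is reached acts as exit or killing, and one that
  is not reached is natural or entrance.
\<close>

definition killed_path :: "(real \<Rightarrow> 'w \<Rightarrow> real option) \<Rightarrow> 'w \<Rightarrow> bool" where
  "killed_path X \<omega> \<longleftrightarrow>
     (\<forall>t\<ge>0. X t \<omega> = None \<longleftrightarrow> lifetime X \<omega> \<le> ennreal t) \<and>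
     (\<forall>t\<ge>0. \<forall>y. X t \<omega> = Some y \<longrightarrow> 0 < y) \<and>
     continuous_on {t. 0 \<le> t \<and> ennreal t < lifetime X \<omega>} (\<lambda>t. the (X t \<omega>)) \<and>
     (0 < lifetime X \<omega> \<and> lifetime X \<omega> < \<infinity> \<longrightarrow>
        ((\<lambda>t. the (X t \<omega>)) \<longlongrightarrow> 0) (at_left (enn2real (lifetime X \<omega>))) \<or>
        filterlim (\<lambda>t. the (X t \<omega>)) at_top (at_left (enn2real (lifetime X \<omega>))))"

definition filtered_prob_space :: "'w measure \<Rightarrow> (ennreal \<Rightarrow> 'w measure) \<Rightarrow> bool" where
  "filtered_prob_space M F \<longleftrightarrow>
     prob_space M \<and> filtration (space M) F \<and> (\<forall>t. subalgebra M (F t))"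

definition brownian_motion ::
    "'w measure \<Rightarrow> (ennreal \<Rightarrow> 'w measure) \<Rightarrow> (real \<Rightarrow> 'w \<Rightarrow> real) \<Rightarrow> bool" where
  "brownian_motion M F W \<longleftrightarrow>
     (\<forall>t\<ge>0. W t \<in> borel_measurable (F (ennreal t))) \<and>
     (AE \<omega> in M. W 0 \<omega> = 0) \<and>
     (AE \<omega> in M. continuous_on {0..} (\<lambda>t. W t \<omega>)) \<and>
     (\<forall>s t. 0 \<le> s \<and> s < t \<longrightarrow>
        distributed M lborel (\<lambda>\<omega>. W t \<omega> - W s \<omega>)
          (\<lambda>y. ennreal (normal_density 0 (sqrt (t - s)) y)) \<and>
        prob_space.indep_set M (sets (F (ennreal s)))
          {(\<lambda>\<omega>. W t \<omega> - W s \<omega>) -` B \<inter> space M | B. B \<in> sets borel})"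

text \<open>
  The elementary integrand given by \<open>N\<close>, \<open>p\<close>, \<open>\<xi>\<close> is
  \<open>\<Sum>i<N. \<xi>\<^sub>i 1\<^bsub>(p\<^sub>i, p\<^sub>i\<^sub>+\<^sub>1]\<^esub>\<close> with bounded \<open>F\<^bsub>p\<^sub>i\<^esub>\<close>-measurable \<open>\<xi>\<^sub>i\<close>.
\<close>

definition elementary_integrand ::
    "(ennreal \<Rightarrow> 'w measure) \<Rightarrow> nat \<Rightarrow> (nat \<Rightarrow> real) \<Rightarrow> (nat \<Rightarrow> 'w \<Rightarrow> real) \<Rightarrow> bool" where
  "elementary_integrand F N p \<xi> \<longleftrightarrow>
     0 \<le> p 0 \<and>
     (\<forall>i<N. p i \<le> p (Suc i) \<and> \<xi> i \<in> borel_measurable (F (ennreal (p i))) \<and>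
        (\<exists>B. \<forall>\<omega>\<in>space (F (ennreal (p i))). \<bar>\<xi> i \<omega>\<bar> \<le> B))"

definition elementary_process ::
    "nat \<Rightarrow> (nat \<Rightarrow> real) \<Rightarrow> (nat \<Rightarrow> 'w \<Rightarrow> real) \<Rightarrow> real \<Rightarrow> 'w \<Rightarrow> real" where
  "elementary_process N p \<xi> s \<omega> = (\<Sum>i<N. \<xi> i \<omega> * indicator {p i<..p (Suc i)} s)"

definition elementary_integral ::
    "(real \<Rightarrow> 'w \<Rightarrow> real) \<Rightarrow> nat \<Rightarrow> (nat \<Rightarrow> real) \<Rightarrow> (nat \<Rightarrow> 'w \<Rightarrow> real) \<Rightarrow> real \<Rightarrow> 'w \<Rightarrow> real" where
  "elementary_integral W N p \<xi> t \<omega> =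
     (\<Sum>i<N. \<xi> i \<omega> * (W (min t (p (Suc i))) \<omega> - W (min t (p i)) \<omega>))"

text \<open>
  \<open>I\<close> is a version of the Ito integral \<open>t \<mapsto> \<integral>\<^sub>0\<^sup>t H\<^sub>s dW\<^sub>s\<close> of a progressively measurable
  \<open>H\<close> that is almost surely locally square integrable: the continuous process that is the limit
  in probability of elementary integrals whose integrands approximate \<open>H\<close> in \<open>L\<^sup>2([0,T])\<close> in
  probability, for every \<open>T\<close>. Such \<open>I\<close> is unique up to indistinguishability. Square
  integrability of \<open>H\<close> follows from the approximation, as elementary integrands are bounded.
  \<open>I\<close> is not required to be adapted to \<open>F\<close> because \<open>F\<close> need not be complete.
\<close>

definition ito_integral ::
    "'w measure \<Rightarrow> (ennreal \<Rightarrow> 'w measure) \<Rightarrow> (real \<Rightarrow> 'w \<Rightarrow> real) \<Rightarrow> (real \<Rightarrow> 'w \<Rightarrow> real) \<Rightarrow>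
      (real \<Rightarrow> 'w \<Rightarrow> real) \<Rightarrow> bool" where
  "ito_integral M F W H I \<longleftrightarrow>
     (\<forall>T\<ge>0. (\<lambda>(s, \<omega>). H s \<omega>) \<in>
        borel_measurable (restrict_space borel {0..T} \<Otimes>\<^sub>M F (ennreal T))) \<and>
     (\<forall>t\<ge>0. I t \<in> borel_measurable M) \<and>
     (AE \<omega> in M. continuous_on {0..} (\<lambda>t. I t \<omega>)) \<and>
     (\<exists>N p \<xi>. (\<forall>n. elementary_integrand F (N n) (p n) (\<xi> n)) \<and>
        (\<forall>T\<ge>0. \<forall>\<epsilon>>0.
          (\<lambda>n. measure M {\<omega> \<in> space M. ennreal \<epsilon> \<le>
             (\<integral>\<^sup>+ s\<in>{0..T}. ennreal ((elementary_process (N n) (p n) (\<xi> n) s \<omega> - H s \<omega>)\<^sup>2)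
                \<partial>lborel)}) \<longlonglongrightarrow> 0) \<and>
        (\<forall>t\<ge>0. \<forall>\<epsilon>>0.
          (\<lambda>n. measure M {\<omega> \<in> space M. \<epsilon> \<le>
             \<bar>elementary_integral W (N n) (p n) (\<xi> n) t \<omega> - I t \<omega>\<bar>}) \<longlonglongrightarrow> 0))"

text \<open>
  Weak solution of \<open>dX = \<mu>(X) dt + \<sigma>(X) dW\<close>, \<open>X\<^sub>0 = x\<close>, up to its lifetime. The equation is
  required up to the exit time of every interval \<open>(a,b)\<close> with \<open>0 < a < x < b < \<infinity>\<close>; on
  \<open>{t < exit time}\<close> the integrand below agrees with \<open>\<sigma>(X\<^sub>s)\<close> for all \<open>s \<le> t\<close>.
\<close>

definition weak_solution ::
    "(real \<Rightarrow> real) \<Rightarrow> (real \<Rightarrow> real) \<Rightarrow> real \<Rightarrow> 'w measure \<Rightarrow> (ennreal \<Rightarrow> 'w measure) \<Rightarrow>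
      (real \<Rightarrow> 'w \<Rightarrow> real) \<Rightarrow> (real \<Rightarrow> 'w \<Rightarrow> real option) \<Rightarrow> bool" where
  "weak_solution \<mu> \<sigma> x M F W X \<longleftrightarrow>
     filtered_prob_space M F \<and>
     brownian_motion M F W \<and>
     (\<forall>t\<ge>0. X t \<in> F (ennreal t) \<rightarrow>\<^sub>M state_space) \<and>
     (\<forall>\<omega>\<in>space M. killed_path X \<omega>) \<and>
     (AE \<omega> in M. X 0 \<omega> = Some x) \<and>
     (\<forall>a b. 0 < a \<and> a < x \<and> x < b \<longrightarrow>
        (\<exists>I. ito_integral M F W
               (\<lambda>s \<omega>. if ennreal s < exit_time X a b \<omega> then \<sigma> (the (X s \<omega>)) else 0) I \<and>
             (AE \<omega> in M. \<forall>t\<ge>0. ennreal t < exit_time X a b \<omega> \<longrightarrow>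
                set_integrable lborel {0..t} (\<lambda>s. \<mu> (the (X s \<omega>))) \<and>
                the (X t \<omega>) = x + (LINT s:{0..t}|lborel. \<mu> (the (X s \<omega>))) + I t \<omega>)))"

definition admissible_coefficients :: "(real \<Rightarrow> real) \<Rightarrow> (real \<Rightarrow> real) \<Rightarrow> bool" where
  "admissible_coefficients \<mu> \<sigma> \<longleftrightarrow>
     set_borel_measurable borel {0<..} \<mu> \<and> set_borel_measurable borel {0<..} \<sigma> \<and>
     (\<forall>x>0. 0 < \<sigma> x) \<and>
     (\<forall>x>0. \<exists>\<epsilon>>0. \<epsilon> < x \<and> set_integrable lborel {x-\<epsilon>..x+\<epsilon>} (\<lambda>y. (1 + \<bar>\<mu> y\<bar>) / (\<sigma> y)\<^sup>2))"

text \<open>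
  The diffusion is the family of weak solutions indexed by the starting point \<open>x\<close>, each on its
  own filtered probability space; \<open>\<^bold>E\<^sub>x\<close> is expectation under \<open>M x\<close>. The last conjunct is
  regularity: every state is reached from every other with positive probability.
\<close>

definition regular_diffusion ::
    "(real \<Rightarrow> real) \<Rightarrow> (real \<Rightarrow> real) \<Rightarrow> (real \<Rightarrow> 'w measure) \<Rightarrow> (real \<Rightarrow> ennreal \<Rightarrow> 'w measure) \<Rightarrow>
      (real \<Rightarrow> real \<Rightarrow> 'w \<Rightarrow> real) \<Rightarrow> (real \<Rightarrow> real \<Rightarrow> 'w \<Rightarrow> real option) \<Rightarrow> bool" where
  "regular_diffusion \<mu> \<sigma> M F W X \<longleftrightarrow>
     admissible_coefficients \<mu> \<sigma> \<and>
     (\<forall>x>0. weak_solution \<mu> \<sigma> x (M x) (F x) (W x) (X x)) \<and>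
     (\<forall>x>0. \<forall>y>0. 0 < measure (M x) {\<omega> \<in> space (M x). hitting_time (X x) y \<omega> < \<infinity>})"

definition upper_semicontinuous_on :: "real set \<Rightarrow> (real \<Rightarrow> real) \<Rightarrow> bool" where
  "upper_semicontinuous_on S g \<longleftrightarrow>
     (\<forall>x\<in>S. \<forall>c. g x < c \<longrightarrow> eventually (\<lambda>y. g y < c) (at x within S))"

definition discount :: "real \<Rightarrow> ennreal \<Rightarrow> real" where
  "discount r \<tau> = (if \<tau> = \<infinity> then 0 else exp (- r * enn2real \<tau>))"

definition payoff ::
    "real \<Rightarrow> (real \<Rightarrow> real) \<Rightarrow> (real \<Rightarrow> 'w \<Rightarrow> real option) \<Rightarrow> ('w \<Rightarrow> ennreal) \<Rightarrow> 'w \<Rightarrow> real" where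
  "payoff r g X \<tau> \<omega> =
     (if \<tau> \<omega> = \<infinity> then 0
      else discount r (\<tau> \<omega>) * (case X (enn2real (\<tau> \<omega>)) \<omega> of None \<Rightarrow> 0 | Some y \<Rightarrow> g y))"

text \<open>
  \<open>g\<close> is not assumed bounded, so a payoff need not be integrable: expectations are extended
  real valued, and the supremum runs over the stopping times whose expected payoff exists, that
  is, whose positive and negative parts do not both have infinite expectation. (In
  \<^typ>\<open>ereal\<close>, \<open>\<infinity> - \<infinity> = \<infinity>\<close>, so without this restriction the value would be \<open>\<infinity>\<close> as soon
  as one expectation fails to exist.)
\<close>

definition quasi_integrable :: "'w measure \<Rightarrow> ('w \<Rightarrow> real) \<Rightarrow> bool" where
  "quasi_integrable M Y \<longleftrightarrow>
     Y \<in> borel_measurable M \<and>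
     ((\<integral>\<^sup>+ \<omega>. ennreal (Y \<omega>) \<partial>M) < \<infinity> \<or> (\<integral>\<^sup>+ \<omega>. ennreal (- Y \<omega>) \<partial>M) < \<infinity>)"

definition ext_expectation :: "'w measure \<Rightarrow> ('w \<Rightarrow> real) \<Rightarrow> ereal" where
  "ext_expectation M Y =
     enn2ereal (\<integral>\<^sup>+ \<omega>. ennreal (Y \<omega>) \<partial>M) - enn2ereal (\<integral>\<^sup>+ \<omega>. ennreal (- Y \<omega>) \<partial>M)"

definition value_function ::
    "real \<Rightarrow> (real \<Rightarrow> real) \<Rightarrow> (real \<Rightarrow> 'w measure) \<Rightarrow> (real \<Rightarrow> ennreal \<Rightarrow> 'w measure) \<Rightarrow>
      (real \<Rightarrow> real \<Rightarrow> 'w \<Rightarrow> real option) \<Rightarrow> real \<Rightarrow> ereal" where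
  "value_function r g M F X x =
     (SUP \<tau> \<in> {\<tau>. stopping_time (F x) \<tau> \<and> quasi_integrable (M x) (payoff r g (X x) \<tau>)}.
        ext_expectation (M x) (payoff r g (X x) \<tau>))"

definition continuation_region ::
    "real \<Rightarrow> (real \<Rightarrow> real) \<Rightarrow> (real \<Rightarrow> 'w measure) \<Rightarrow> (real \<Rightarrow> ennreal \<Rightarrow> 'w measure) \<Rightarrow>
      (real \<Rightarrow> real \<Rightarrow> 'w \<Rightarrow> real option) \<Rightarrow> real set" where
  "continuation_region r g M F X = {x. 0 < x \<and> value_function r g M F X x > ereal (g x)}"

text \<open>
  \<open>(\<A> - r) u = 0\<close> on \<open>(0,\<infinity>)\<close>. As \<open>\<mu>\<close> and \<open>\<sigma>\<close> are only measurable, a solution is a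
  \<open>C\<^sup>1\<close> function with locally absolutely continuous derivative \<open>u1\<close> satisfying the equation
  almost everywhere; \<open>u2\<close> is the density of \<open>u1\<close>.
\<close>

definition generator_solution ::
    "(real \<Rightarrow> real) \<Rightarrow> (real \<Rightarrow> real) \<Rightarrow> real \<Rightarrow> (real \<Rightarrow> real) \<Rightarrow> bool" where
  "generator_solution \<mu> \<sigma> r u \<longleftrightarrow>
     (\<exists>u1 u2. (\<forall>x>0. (u has_real_derivative u1 x) (at x)) \<and>
        (\<forall>a b. 0 < a \<and> a \<le> b \<longrightarrow>
           set_integrable lborel {a..b} u2 \<and> u1 b - u1 a = (LINT y:{a..b}|lborel. u2 y)) \<and>
        (AE x in lborel. 0 < x \<longrightarrow> (1/2) * (\<sigma> x)\<^sup>2 * u2 x + \<mu> x * u1 x - r * u x = 0))"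

text \<open>
  The equation, positivity and monotonicity alone do not single out \<open>\<psi>\<close> and \<open>\<phi>\<close> when a
  boundary can be reached; the Laplace transforms of the hitting times do, up to constant
  factors. The integrand vanishes on \<open>{\<tau>\<^sub>z = \<infinity>}\<close>.
\<close>

definition fundamental_solutions ::
    "(real \<Rightarrow> real) \<Rightarrow> (real \<Rightarrow> real) \<Rightarrow> real \<Rightarrow> (real \<Rightarrow> 'w measure) \<Rightarrow>
      (real \<Rightarrow> real \<Rightarrow> 'w \<Rightarrow> real option) \<Rightarrow> (real \<Rightarrow> real) \<Rightarrow> (real \<Rightarrow> real) \<Rightarrow> bool" where
  "fundamental_solutions \<mu> \<sigma> r M X \<psi> \<phi> \<longleftrightarrow>
     generator_solution \<mu> \<sigma> r \<psi> \<and> (\<forall>x>0. 0 < \<psi> x) \<and> mono_on {0<..} \<psi> \<and>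
     generator_solution \<mu> \<sigma> r \<phi> \<and> (\<forall>x>0. 0 < \<phi> x) \<and> antimono_on {0<..} \<phi> \<and>
     (\<forall>x z. 0 < x \<and> x \<le> z \<longrightarrow>
        (\<integral>\<omega>. discount r (hitting_time (X x) z \<omega>) \<partial>M x) = \<psi> x / \<psi> z) \<and>
     (\<forall>x z. 0 < z \<and> z \<le> x \<longrightarrow>
        (\<integral>\<omega>. discount r (hitting_time (X x) z \<omega>) \<partial>M x) = \<phi> x / \<phi> z)"

text \<open>For functions on \<open>(0,\<infinity>)\<close>, hence the restriction \<open>0 \<le> a\<close>.\<close>

definition strictly_increasing_at :: "(real \<Rightarrow> real) \<Rightarrow> real \<Rightarrow> bool" where
  "strictly_increasing_at f x \<longleftrightarrow> (\<exists>a b. 0 \<le> a \<and> a < x \<and> x < b \<and> strict_mono_on {a<..<b} f)"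

definition strictly_decreasing_at :: "(real \<Rightarrow> real) \<Rightarrow> real \<Rightarrow> bool" where
  "strictly_decreasing_at f x \<longleftrightarrow>
     (\<exists>a b. 0 \<le> a \<and> a < x \<and> x < b \<and> strict_antimono_on {a<..<b} f)"

end

theory Submission
  imports Defs
begin

text \<open>
  Stopping when \<open>X\<close> first hits \<open>z\<close> yields \<open>g z * \<psi> x / \<psi> z\<close> if \<open>x \<le> z\<close>, and
  \<open>g z * \<phi> x / \<phi> z\<close> if \<open>z \<le> x\<close>. Where \<open>g / \<psi>\<close> is strictly increasing, a \<open>z\<close> slightly
  above \<open>x\<close> makes this exceed \<open>g x\<close>; for \<open>g / \<phi>\<close> take \<open>z\<close> slightly below \<open>x\<close>. The filtration
  is neither complete nor right-continuous, so that the hitting time is a stopping time rests on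
  the continuity of every path: hitting \<open>z\<close> by time \<open>t\<close> means coming arbitrarily close to \<open>z\<close> at
  rational times before \<open>t\<close> or at \<open>t\<close>.
\<close>

section \<open>Limits of killed paths and hitting times\<close>

text \<open>
  The limit time \<open>l\<close> cannot be the lifetime, because there the path tends to \<open>0\<close> or \<open>\<infinity>\<close>.
\<close>

lemma killed_path_limit:
  assumes path: "killed_path X \<omega>" and z: "0 < z"
    and q: "\<And>n. 0 \<le> q n" "q \<longlonglongrightarrow> l"
    and Xq: "\<And>n. X (q n) \<omega> = Some (y n)" and y: "y \<longlonglongrightarrow> z"
  shows "X l \<omega> = Some z"
proof -
  let ?L = "lifetime X \<omega>"
  have l: "0 \<le> l"
    using q by (intro LIMSEQ_le_const[OF q(2)]) auto
  have none: "X t \<omega> = None \<longleftrightarrow> ?L \<le> ennreal t" if "0 \<le> t" for t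
    using path that unfolding killed_path_def by blast
  have qL: "ennreal (q n) < ?L" for n
    using none[OF q(1), of n] Xq[of n] by (simp add: not_le[symmetric])
  have y': "(\<lambda>n. the (X (q n) \<omega>)) \<longlonglongrightarrow> z"
    using y by (simp add: Xq)
  have "ennreal l \<le> ?L"
    by (rule LIMSEQ_le_const2[OF tendsto_ennrealI[OF q(2)]]) (use qL less_imp_le in blast)
  then consider "ennreal l < ?L" | "?L = ennreal l" by fastforce
  then show ?thesis
  proof cases
    case 1
    have "continuous_on {t. 0 \<le> t \<and> ennreal t < ?L} (\<lambda>t. the (X t \<omega>))"
      using path unfolding killed_path_def by blast
    from continuous_on_tendsto_compose[OF this q(2)]
    have "(\<lambda>n. the (X (q n) \<omega>)) \<longlonglongrightarrow> the (X l \<omega>)"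
      using 1 l q(1) qL by auto
    with y' have "the (X l \<omega>) = z" by (rule LIMSEQ_unique[rotated])
    moreover have "X l \<omega> \<noteq> None" using none[OF l] 1 by simp
    ultimately show ?thesis by auto
  next
    case 2
    have "q n < l" for n using qL[of n] 2 q(1)[of n] by (simp add: ennreal_less_iff)
    \<comment> \<open>As every \<open>q n\<close> lies strictly before \<open>l\<close>, the
      one-sided limit of the path at its lifetime is also the limit along \<open>q\<close>. That
      limit is \<open>0\<close> or infinite, which contradicts convergence to
      \<open>z\<close>.\<close>
    then have left: "filterlim q (at_left l) sequentially"
      using q(2) by (auto simp: filterlim_at less_imp_neq intro!: always_eventually)
    \<comment> \<open>The boundary clause of \<open>killed_path\<close> asks for a positive finite
      lifetime; finiteness comes from \<open>?L = ennreal l\<close>.\<close>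
    have "0 < ?L" using qL[of 0] by (rule le_less_trans[rotated]) simp
    then consider "((\<lambda>t. the (X t \<omega>)) \<longlongrightarrow> 0) (at_left l)"
      | "filterlim (\<lambda>t. the (X t \<omega>)) at_top (at_left l)"
      using path 2 l unfolding killed_path_def by auto
    then show ?thesis
    proof cases
      case 1
      from LIMSEQ_unique[OF filterlim_compose[OF 1 left] y'] z show ?thesis by simp
    next
      case 2
      from not_tendsto_and_filterlim_at_infinity[OF _ y'
          filterlim_at_top_imp_at_infinity[OF filterlim_compose[OF 2 left]]]
      show ?thesis by simp
    qed
  qed
qed

text \<open>The right-hand side involves only countably many times, none after \<open>t\<close>, so
  it yields an event of the filtration at \<open>t\<close>. From left to right, continuity at a hit
  \<open>s < t\<close> supplies rationals just after \<open>s\<close>, and a hit at \<open>t\<close>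
  itself is witnessed by the inserted point. From right to left, compactness gives a limit time and
  \<open>killed_path_limit\<close> shows that the path is at \<open>z\<close> there.\<close>

lemma killed_path_hits_iff:
  assumes path: "killed_path X \<omega>" and z: "0 < z" and t: "0 \<le> t"
  shows "(\<exists>s\<in>{0..t}. X s \<omega> = Some z) \<longleftrightarrow>
    (\<forall>n::nat. \<exists>q\<in>insert t (\<rat> \<inter> {0..t}). X q \<omega> \<in> Some ` ball z (inverse (Suc n)))"
    (is "?hit \<longleftrightarrow> ?near")
proof
  assume ?hit
  then obtain s where s: "0 \<le> s" "s \<le> t" "X s \<omega> = Some z" by auto
  have none: "X u \<omega> = None \<longleftrightarrow> lifetime X \<omega> \<le> ennreal u" if "0 \<le> u" for u
    using path that unfolding killed_path_def by blast
  let ?A = "{u. 0 \<le> u \<and> ennreal u < lifetime X \<omega>}"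
  have sA: "s \<in> ?A" using none[OF s(1)] s by (simp add: not_le[symmetric])
  show ?near
  proof
    fix n
    show "\<exists>q\<in>insert t (\<rat> \<inter> {0..t}). X q \<omega> \<in> Some ` ball z (inverse (Suc n))"
    proof (cases "s = t")
      case True
      then show ?thesis using s by auto
    next
      case False
      have "continuous_on ?A (\<lambda>u. the (X u \<omega>))"
        using path unfolding killed_path_def by blast
      from this[unfolded continuous_on_iff, rule_format, OF sA, of "inverse (Suc n)"]
      obtain d where d: "0 < d"
        "\<And>u. u \<in> ?A \<Longrightarrow> dist u s < d \<Longrightarrow> dist (the (X u \<omega>)) (the (X s \<omega>)) < inverse (Suc n)"
        by auto
      \<comment> \<open>The lifetime may be infinite, so an intermediate \<open>e\<close> provides a
        real upper bound for the rational \<open>q\<close>.\<close>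
      obtain e where e: "ennreal s < e" "e < lifetime X \<omega>" using sA dense by blast
      then have "e \<noteq> \<top>" by auto
      then obtain e' where e': "e = ennreal e'" "0 \<le> e'" by (cases e) auto
      have "s < Min {t, s + d, e'}"
        using e e' s False d by (auto simp: ennreal_less_iff)
      then obtain q where q: "q \<in> \<rat>" "s < q" "q < Min {t, s + d, e'}"
        using Rats_dense_in_real by blast
      have "ennreal q \<le> e" using q e' by (auto intro: ennreal_leI)
      then have qA: "q \<in> ?A" using q e s by auto
      have "dist (the (X q \<omega>)) z < inverse (Suc n)"
        using d(2)[OF qA] q s by (auto simp: dist_real_def)
      moreover obtain y where "X q \<omega> = Some y"
        using none[of q] qA by auto
      ultimately have "X q \<omega> \<in> Some ` ball z (inverse (Suc n))"
        by (auto simp: dist_commute)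
      then show ?thesis using q s by (intro bexI[of _ q]) auto
    qed
  qed
next
  assume ?near
  then have "\<forall>n::nat. \<exists>q y. q \<in> {0..t} \<and> X q \<omega> = Some y \<and> dist z y < inverse (Suc n)"
    using t by fastforce
  then obtain q y where q: "\<And>n::nat. q n \<in> {0..t}" "\<And>n. X (q n) \<omega> = Some (y n)"
      "\<And>n. dist z (y n) < inverse (Suc n)"
    by metis
  obtain l \<rho> where l: "l \<in> {0..t}" "strict_mono (\<rho> :: nat \<Rightarrow> nat)" "(q \<circ> \<rho>) \<longlonglongrightarrow> l"
    using compact_imp_seq_compact[OF compact_Icc, of 0 t] q(1) unfolding seq_compact_def by metis
  have "(\<lambda>n. dist (y n) z) \<longlonglongrightarrow> 0"
    by (rule tendsto_sandwich[OF _ _ tendsto_const LIMSEQ_inverse_real_of_nat])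
      (use q(3) in \<open>auto simp: dist_commute intro!: always_eventually less_imp_le\<close>)
  then have "y \<longlonglongrightarrow> z" by (rule iffD2[OF tendsto_dist_iff])
  then have "(y \<circ> \<rho>) \<longlonglongrightarrow> z" using l(2) by (rule LIMSEQ_subseq_LIMSEQ)
  then have "X l \<omega> = Some z"
    using q l(3) by (intro killed_path_limit[OF path z, of "q \<circ> \<rho>" l "y \<circ> \<rho>"]) auto
  then show ?hit using l(1) by blast
qed

text \<open>Choose hitting instants converging to the infimum; \<open>killed_path_limit\<close>,
  applied with the constant sequence \<open>z\<close>, carries the hit over to their limit.\<close>

lemma hitting_time_attained:
  assumes path: "killed_path X \<omega>" and z: "0 < z" and fin: "hitting_time X z \<omega> \<noteq> \<infinity>"
  shows "X (enn2real (hitting_time X z \<omega>)) \<omega> = Some z"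
proof -
  let ?S = "{ennreal t | t. 0 \<le> t \<and> X t \<omega> = Some z}"
  have h: "hitting_time X z \<omega> = Inf ?S" by (simp add: hitting_time_def)
  have ne: "?S \<noteq> {}"
  proof
    assume "?S = {}"
    then show False using fin unfolding h by (metis Inf_empty infinity_ennreal_def)
  qed
  obtain f where f: "\<And>n. f n \<in> ?S" "f \<longlonglongrightarrow> Inf ?S"
    using Inf_as_limit[OF ne] by auto
  then have "\<forall>n. \<exists>t. f n = ennreal t \<and> 0 \<le> t \<and> X t \<omega> = Some z" by blast
  then obtain q where q: "\<And>n. f n = ennreal (q n)" "\<And>n. 0 \<le> q n" "\<And>n. X (q n) \<omega> = Some z"
    by metis
  have "(\<lambda>n. enn2real (f n)) \<longlonglongrightarrow> enn2real (Inf ?S)"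
    using fin f(2) unfolding h by (intro tendsto_enn2real) (auto simp: less_top[symmetric])
  then have "q \<longlonglongrightarrow> enn2real (Inf ?S)" by (simp add: q)
  from killed_path_limit[OF path z q(2) this q(3) tendsto_const]
  show ?thesis unfolding h .
qed

text \<open>Attainment of the infimum makes the path on the closed interval up to \<open>t\<close>
  decide the event, with no look beyond \<open>t\<close>. A filtration that is not right-continuous
  calls for exactly this.\<close>

lemma hitting_time_le_iff:
  assumes path: "killed_path X \<omega>" and z: "0 < z" and t: "0 \<le> t"
  shows "hitting_time X z \<omega> \<le> ennreal t \<longleftrightarrow> (\<exists>s\<in>{0..t}. X s \<omega> = Some z)"
proof
  assume le: "hitting_time X z \<omega> \<le> ennreal t"
  then have fin: "hitting_time X z \<omega> \<noteq> \<infinity>" by (auto simp: top_unique)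
  have "enn2real (hitting_time X z \<omega>) \<le> t"
    using enn2real_mono[OF le] t by simp
  then show "\<exists>s\<in>{0..t}. X s \<omega> = Some z"
    using hitting_time_attained[OF path z fin] by (intro bexI) auto
next
  assume "\<exists>s\<in>{0..t}. X s \<omega> = Some z"
  then obtain s where s: "0 \<le> s" "s \<le> t" "X s \<omega> = Some z" by auto
  then have "hitting_time X z \<omega> \<le> ennreal s"
    unfolding hitting_time_def by (intro Inf_lower) auto
  also have "\<dots> \<le> ennreal t" using s by (intro ennreal_leI)
  finally show "hitting_time X z \<omega> \<le> ennreal t" .
qed

lemma stopping_time_hitting_time:
  assumes sol: "weak_solution \<mu> \<sigma> x M F W X" and z: "0 < z"
  shows "stopping_time F (hitting_time X z)"
  unfolding stopping_time_def
proof (intro allI)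
  fix t :: ennreal
  have filt: "filtration (space M) F" and path: "\<And>\<omega>. \<omega> \<in> space M \<Longrightarrow> killed_path X \<omega>"
    and X: "\<And>s. 0 \<le> s \<Longrightarrow> X s \<in> F (ennreal s) \<rightarrow>\<^sub>M state_space"
    using sol unfolding weak_solution_def filtered_prob_space_def by auto
  have sp: "space (F s) = space M" for s using filt by (simp add: filtration.space_F)
  show "Measurable.pred (F t) (\<lambda>\<omega>. hitting_time X z \<omega> \<le> t)"
  proof (cases t)
    case (real u)
    let ?D = "insert u (\<rat> \<inter> {0..u})"
    have "Measurable.pred (F t) (\<lambda>\<omega>. \<forall>n::nat. \<exists>q\<in>?D. X q \<omega> \<in> Some ` ball z (inverse (Suc n)))"
      unfolding pred_def
    proof (intro sets.sets_Collect_countable_All sets.sets_Collect_countable_Ex')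
      show "countable ?D" by (auto intro: countable_subset[OF _ countable_rat])
      fix n q assume q: "q \<in> ?D"
      have "sets (F (ennreal q)) \<subseteq> sets (F t)"
        using filt q real by (intro filtration.sets_F_mono[OF filt]) (auto intro: ennreal_leI)
      \<comment> \<open>The ball is Borel, so its image under \<open>Some\<close> is one of the
        generators of \<open>state_space\<close>.\<close>
      moreover have "Some ` ball z (inverse (Suc n)) \<in> sets state_space"
        unfolding state_space_def by (auto simp: sets_measure_of intro!: sigma_sets.Basic)
      moreover have "0 \<le> q" using q real by auto
      ultimately have "X q -` (Some ` ball z (inverse (Suc n))) \<inter> space M \<in> sets (F t)"
        using measurable_sets[OF X] by (metis sp subset_eq)
      then show "{\<omega> \<in> space (F t). X q \<omega> \<in> Some ` ball z (inverse (Suc n))} \<in> sets (F t)"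
        by (auto simp: sp vimage_def Int_def conj_commute)
    qed
    then show ?thesis
      by (subst measurable_cong)
        (use path real z in \<open>auto simp: sp hitting_time_le_iff killed_path_hits_iff\<close>)
  \<comment> \<open>At \<open>t = \<top>\<close> the inequality always holds.\<close>
  qed simp
qed

section \<open>Expected payoffs and lower bounds for the value\<close>

lemma ext_expectation_eq_integral:
  assumes "integrable M Y"
  shows "ext_expectation M Y = ereal (integral\<^sup>L M Y)"
proof -
  have "(\<integral>\<^sup>+ \<omega>. ennreal (Y \<omega>) \<partial>M) \<noteq> \<infinity>" "(\<integral>\<^sup>+ \<omega>. ennreal (- Y \<omega>) \<partial>M) \<noteq> \<infinity>"
    using assms real_integrable_def by auto
  then show ?thesis
    using assms unfolding ext_expectation_def
    by (cases "\<integral>\<^sup>+ \<omega>. ennreal (Y \<omega>) \<partial>M"; cases "\<integral>\<^sup>+ \<omega>. ennreal (- Y \<omega>) \<partial>M")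
      (auto simp: real_lebesgue_integral_def enn2ereal_ennreal)
qed

lemma integrable_imp_quasi_integrable:
  assumes "integrable M Y"
  shows "quasi_integrable M Y"
  using assms real_integrable_def
  unfolding quasi_integrable_def by (auto simp: less_top[symmetric])

text \<open>The hitting time of \<open>z\<close> competes in the supremum: its payoff is a constant
  multiple of a discount factor in the unit interval, hence integrable whatever the sign of
  \<open>g z\<close>.\<close>

lemma value_function_ge_hitting:
  assumes sol: "weak_solution \<mu> \<sigma> x (M x) (F x) (W x) (X x)" and z: "0 < z" and r: "0 \<le> r"
  shows "ereal (g z * (\<integral>\<omega>. discount r (hitting_time (X x) z \<omega>) \<partial>M x)) \<le> value_function r g M F X x"
proof -
  let ?\<tau> = "hitting_time (X x) z"
  have fps: "filtered_prob_space (M x) (F x)"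
    and path: "\<And>\<omega>. \<omega> \<in> space (M x) \<Longrightarrow> killed_path (X x) \<omega>"
    using sol unfolding weak_solution_def by auto
  interpret prob_space "M x" using fps unfolding filtered_prob_space_def by blast
  have sub: "\<And>t. subalgebra (M x) (F x t)" using fps unfolding filtered_prob_space_def by blast
  have st: "stopping_time (F x) ?\<tau>" using sol z by (rule stopping_time_hitting_time)
  have [measurable]: "?\<tau> \<in> borel_measurable (M x)"
    using sub unfolding subalgebra_def by (intro measurable_stopping_time[OF st]) auto
  have "integrable (M x) (\<lambda>\<omega>. discount r (?\<tau> \<omega>))"
  proof (rule integrable_const_bound[of _ 1])
    show "(\<lambda>\<omega>. discount r (?\<tau> \<omega>)) \<in> borel_measurable (M x)"
      unfolding discount_def by measurable
  qed (use r in \<open>auto simp: discount_def\<close>)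
  then have int: "integrable (M x) (\<lambda>\<omega>. g z * discount r (?\<tau> \<omega>))" by simp
  \<comment> \<open>Where the hitting time is finite the path is at \<open>z\<close>; where it is
    infinite both sides are \<open>0\<close>.\<close>
  have eq: "payoff r g (X x) ?\<tau> \<omega> = g z * discount r (?\<tau> \<omega>)" if "\<omega> \<in> space (M x)" for \<omega>
    using hitting_time_attained[OF path[OF that] z] by (auto simp: payoff_def discount_def)
  have int': "integrable (M x) (payoff r g (X x) ?\<tau>)"
    using int by (subst Bochner_Integration.integrable_cong[OF refl eq])
  have "ereal (g z * (\<integral>\<omega>. discount r (?\<tau> \<omega>) \<partial>M x)) = ext_expectation (M x) (payoff r g (X x) ?\<tau>)"
    using int' by (simp add: ext_expectation_eq_integral Bochner_Integration.integral_cong[OF refl eq])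
  also have "\<dots> \<le> value_function r g M F X x"
    unfolding value_function_def
    using st integrable_imp_quasi_integrable[OF int'] by (intro SUP_upper) auto
  finally show ?thesis .
qed

text \<open>Here \<open>h\<close> stands for either fundamental solution. Whether \<open>z\<close>
  lies above or below \<open>x\<close> enters only through the Laplace transform hypothesis, so both
  halves of the theorem share this argument.\<close>

lemma continuation_regionI:
  assumes "weak_solution \<mu> \<sigma> x (M x) (F x) (W x) (X x)" and "0 < z" "0 \<le> r" "0 < x"
    and h: "0 < h x" "g x / h x < g z / h z"
    and laplace: "(\<integral>\<omega>. discount r (hitting_time (X x) z \<omega>) \<partial>M x) = h x / h z"
  shows "x \<in> continuation_region r g M F X"
proof -
  have "g x < g z * (h x / h z)"
    using h by (simp add: pos_divide_less_eq)
  also have "ereal (g z * (h x / h z)) \<le> value_function r g M F X x"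
    using value_function_ge_hitting[where M = M and F = F and W = W and X = X, OF assms(1-3), of g] by (simp add: laplace)
  finally show ?thesis using \<open>0 < x\<close> by (simp add: continuation_region_def)
qed

theorem lemma3p8:
  fixes \<mu> \<sigma> g \<psi> \<phi> :: "real \<Rightarrow> real" and r :: real
    and M :: "real \<Rightarrow> 'w measure" and F :: "real \<Rightarrow> ennreal \<Rightarrow> 'w measure"
    and W :: "real \<Rightarrow> real \<Rightarrow> 'w \<Rightarrow> real" and X :: "real \<Rightarrow> real \<Rightarrow> 'w \<Rightarrow> real option"
  assumes diffusion: "regular_diffusion \<mu> \<sigma> M F W X"
    and r_pos: "0 < r"
    and g_usc: "upper_semicontinuous_on {0<..} g"
    and g_pos: "\<exists>x>0. 0 < g x"
    and fundamental: "fundamental_solutions \<mu> \<sigma> r M X \<psi> \<phi>"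
  shows "{x. 0 < x \<and> strictly_increasing_at (\<lambda>y. g y / \<psi> y) x} \<subseteq> continuation_region r g M F X \<and>
         {x. 0 < x \<and> strictly_decreasing_at (\<lambda>y. g y / \<phi> y) x} \<subseteq> continuation_region r g M F X"
proof (intro conjI subsetI; clarify)
  fix x :: real assume x: "0 < x"
  have sol: "weak_solution \<mu> \<sigma> x (M x) (F x) (W x) (X x)"
    using diffusion x unfolding regular_diffusion_def by blast
  {
    assume "strictly_increasing_at (\<lambda>y. g y / \<psi> y) x"
    then obtain a b where ab: "a < x" "x < b" "strict_mono_on {a<..<b} (\<lambda>y. g y / \<psi> y)"
      unfolding strictly_increasing_at_def by blast
    \<comment> \<open>The Laplace transform is expressed through \<open>\<psi>\<close> for targets
      above the starting point, hence \<open>z\<close> to the right of \<open>x\<close>.\<close>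
    obtain z where z: "x < z" "z < b" using dense[OF ab(2)] by blast
    show "x \<in> continuation_region r g M F X"
    proof (rule continuation_regionI[where h = \<psi> and M = M and F = F and W = W and X = X, OF sol])
      show "g x / \<psi> x < g z / \<psi> z" using ab z by (auto intro: strict_mono_onD)
      show "(\<integral>\<omega>. discount r (hitting_time (X x) z \<omega>) \<partial>M x) = \<psi> x / \<psi> z"
        using fundamental x z unfolding fundamental_solutions_def by simp
    qed (use fundamental x z r_pos in \<open>auto simp: fundamental_solutions_def\<close>)
  next
    assume "strictly_decreasing_at (\<lambda>y. g y / \<phi> y) x"
    then obtain a b where ab: "0 \<le> a" "a < x" "x < b" "strict_antimono_on {a<..<b} (\<lambda>y. g y / \<phi> y)"
      unfolding strictly_decreasing_at_def by blast
    \<comment> \<open>For \<open>\<phi>\<close> the target lies below \<open>x\<close>; with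
      \<open>0 \<le> a\<close> it is still a positive state.\<close>
    obtain z where z: "a < z" "z < x" using dense[OF ab(2)] by blast
    show "x \<in> continuation_region r g M F X"
    proof (rule continuation_regionI[where h = \<phi> and M = M and F = F and W = W and X = X, OF sol])
      show "g x / \<phi> x < g z / \<phi> z" using ab z by (auto simp: monotone_on_def)
      show "(\<integral>\<omega>. discount r (hitting_time (X x) z \<omega>) \<partial>M x) = \<phi> x / \<phi> z"
        using fundamental x z ab unfolding fundamental_solutions_def by simp
    qed (use fundamental x z ab r_pos in \<open>auto simp: fundamental_solutions_def\<close>)
  }
qed

end
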